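(* Let $P\subseteq\mathbb{R}^3$ be the tetrahedron with vertices $(0,0,0)$, $(1,0,0)$, $(0,1,0)$, $(1,7,8)$, and for $k\ge1$ let $P^k=P\times\cdots\times P\subseteq\mathbb{R}^{3k}$ be its $k$-fold Cartesian product. Write $f_{P^k}(x)=f_{k,0}+f_{k,1}x+\cdots+f_{k,3k}x^{3k}$. Then $f_{k,1}^2<f_{k,0}f_{k,2}$ for all $k\ge1$. In particular, for all $k\ge1$ the $h^*$-polynomial of $P^k$ is not log-concave and hence not real-rooted.
   Context: For a lattice polytope $Q\subseteq\mathbb{R}^n$, its Ehrhart polynomial $E_Q$ is the polynomial with $E_Q(j)=|jQ\cap\mathbb{Z}^n|$ for all integers $j\ge0$, and its $h^*$-polynomial $h^*_Q$ is defined by $\sum_{j\ge0}E_Q(j)x^j=h^*_Q(x)/(1-x)^{\dim Q+1}$. Let $\mathscr{E}:\mathbb{R}[x]\to\mathbb{R}[x]$ be the linear map with $\binom{x}{j}\mapsto x^j$ for all $j\ge0$, and $f_Q=\mathscr{E}(E_Q)$; equivalently $f_Q(x)=(1+x)^{\dim Q}h^*_Q\big(\tfrac{x}{1+x}\big)$. A polynomial $\sum a_jx^j$ is log-concave if $a_j^2\ge a_{j-1}a_{j+1}$ for all interior $j$. *)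

theory Defs
  imports "HOL-Analysis.Analysis" "HOL-Computational_Algebra.Polynomial_FPS"
begin

unbundle no fps_syntax

definition int_lattice :: "(real ^ 'n) set" where
  "int_lattice = {x. \<forall>i. x $ i \<in> \<int>}"

definition lattice_count :: "(real ^ 'n) set \<Rightarrow> nat \<Rightarrow> nat" where
  "lattice_count Q j = card ((\<lambda>x. real j *\<^sub>R x) ` Q \<inter> int_lattice)"

definition ehrhart_poly :: "(real ^ 'n) set \<Rightarrow> real poly" where
  "ehrhart_poly Q = (THE E. \<forall>j. poly E (real j) = real (lattice_count Q j))"

definition hstar_poly :: "(real ^ 'n) set \<Rightarrow> real poly" where
  "hstar_poly Q = (THE h.
     Abs_fps (\<lambda>j. poly (ehrhart_poly Q) (real j)) =
       fps_of_poly h / (1 - fps_X) ^ nat (aff_dim Q + 1))"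

text \<open>The polynomial ``x choose j'' in the indeterminate x. It is not written with \<open>gchoose\<close>,
  which is restricted to fields of characteristic zero.\<close>

definition binom_poly :: "nat \<Rightarrow> real poly" where
  "binom_poly j = smult (1 / fact j) (\<Prod>i<j. [:- real i, 1:])"

text \<open>Linearity is spelled out because \<^typ>\<open>real poly\<close> carries no \<^class>\<open>real_vector\<close>
  structure.\<close>

definition binom_to_monom :: "real poly \<Rightarrow> real poly" where
  "binom_to_monom = (THE L.
     (\<forall>p q. L (p + q) = L p + L q) \<and>
     (\<forall>c p. L (smult c p) = smult c (L p)) \<and>
     (\<forall>j. L (binom_poly j) = monom 1 j))"

definition f_poly :: "(real ^ 'n) set \<Rightarrow> real poly" where
  "f_poly Q = binom_to_monom (ehrhart_poly Q)"

definition log_concave :: "real poly \<Rightarrow> bool" where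
  "log_concave p \<longleftrightarrow>
     (\<forall>j. 0 < j \<and> j < degree p \<longrightarrow> coeff p (j - 1) * coeff p (j + 1) \<le> (coeff p j)\<^sup>2)"

definition real_rooted :: "real poly \<Rightarrow> bool" where
  "real_rooted p \<longleftrightarrow>
     p = 0 \<or> (\<forall>z::complex. poly (map_poly complex_of_real p) z = 0 \<longrightarrow> z \<in> \<real>)"

definition tetra :: "(real ^ 3) set" where
  "tetra = convex hull
     {vector [0, 0, 0], vector [1, 0, 0], vector [0, 1, 0], vector [1, 7, 8]}"

text \<open>The \<open>k\<close>-fold Cartesian product of \<open>Q \<subseteq> \<real>\<^sup>n\<close>, where \<open>k = CARD('k)\<close>: the coordinates of
  \<open>\<real>\<^sup>k\<^sup>n\<close> are indexed by \<open>'k \<times> 'n\<close>, and \<open>x $ (i, j)\<close> is the \<open>j\<close>-th coordinate of the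
  \<open>i\<close>-th factor.\<close>

definition cart_power :: "(real ^ 'n) set \<Rightarrow> (real ^ ('k::finite \<times> 'n)) set" where
  "cart_power Q = {x. \<forall>i. (\<chi> j. x $ (i, j)) \<in> Q}"

end

theory Submission
  imports Defs "HOL-Computational_Algebra.Fundamental_Theorem_Algebra"
begin

text \<open>The Ehrhart polynomial of the tetrahedron takes the values 1, 4, 17 at 0, 1, 2, and that of a
  Cartesian power is the $k$-th power of it. Hence $f_{k,0} = 1$, $f_{k,1} = 4^k - 1$ and
  $f_{k,2} = 17^k - 2 \cdot 4^k + 1$, and the inequality is $16^k < 17^k$. With $n = 3k + 1$ the
  $h^*$-polynomial starts with the coefficients 1, $4^k - n$ and $17^k - n 4^k + n (n - 1) / 2$, and
  since $n \le 4^k$ it violates log-concavity at the same place. A real-rooted polynomial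
  with constant term 1 would even satisfy $2 h_2 \le h_1^2$.\<close>


section \<open>Polynomials in the binomial basis\<close>

text \<open>By Newton's formula the coefficient of p at \<open>binom_poly j\<close> is the j-th
  forward difference of p at 0. This makes \<open>binom_to_monom\<close> computable.\<close>

definition fwd_diff :: "real poly \<Rightarrow> real poly" where
  "fwd_diff p = pcompose p [:1, 1:] - p"

lemma poly_fwd_diff: "poly (fwd_diff p) x = poly p (x + 1) - poly p x"
  by (simp add: fwd_diff_def poly_pcompose add.commute)

lemma fwd_diff_add: "fwd_diff (p + q) = fwd_diff p + fwd_diff q"
  by (simp add: fwd_diff_def pcompose_add)

lemma fwd_diff_smult: "fwd_diff (smult c p) = smult c (fwd_diff p)"
  by (simp add: fwd_diff_def pcompose_smult smult_diff_right)

lemma fwd_diff_iter_add: "(fwd_diff ^^ j) (p + q) = (fwd_diff ^^ j) p + (fwd_diff ^^ j) q"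
  by (induction j) (simp_all add: fwd_diff_add)

lemma fwd_diff_iter_smult: "(fwd_diff ^^ j) (smult c p) = smult c ((fwd_diff ^^ j) p)"
  by (induction j) (simp_all add: fwd_diff_smult)

lemma degree_diff_lt:
  fixes p q :: "'a::ab_group_add poly"
  assumes "degree p = degree q" "lead_coeff p = lead_coeff q" "0 < degree p"
  shows "degree (p - q) < degree p"
proof -
  have "degree (p - q) \<le> degree p - 1"
  proof (rule degree_le, intro allI impI)
    fix i assume "degree p - 1 < i"
    then have "i = degree p \<or> i > degree p" by linarith
    then show "coeff (p - q) i = 0"
      using assms by (auto simp: coeff_eq_0)
  qed
  then show ?thesis using assms(3) by linarith
qed

text \<open>A shift preserves degree and leading coefficient, so the top terms cancel. It serves
  forward differences with c = 1 and backward differences with c = -1.\<close>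

lemma degree_shift_diff_lt:
  fixes p :: "real poly"
  assumes "0 < degree p"
  shows "degree (pcompose p [:c, 1:] - p) < degree p"
  using degree_diff_lt[of "pcompose p [:c, 1:]" p] lead_coeff_comp[of "[:c, 1:]" p] assms
  by (simp add: degree_pcompose)

text \<open>Each difference lowers a positive degree and kills constants. Hence only finitely many
  Newton coefficients are nonzero.\<close>

lemma fwd_diff_iter_eq_0: "degree p < j \<Longrightarrow> (fwd_diff ^^ j) p = 0"
proof (induction j arbitrary: p)
  case (Suc j)
  show ?case
  proof (cases "degree p = 0")
    case True
    then obtain c where "p = [:c:]" by (elim degree_eq_zeroE)
    then have "fwd_diff p = 0" by (simp add: fwd_diff_def)
    moreover have "(fwd_diff ^^ j) 0 = 0"
      by (induction j) (simp_all add: fwd_diff_def)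
    ultimately show ?thesis by (simp add: funpow_Suc_right del: funpow.simps)
  next
    case False
    then have "degree (fwd_diff p) < degree p"
      unfolding fwd_diff_def by (intro degree_shift_diff_lt) simp
    then have "degree (fwd_diff p) < j" using Suc.prems by linarith
    then show ?thesis
      using Suc.IH by (simp add: funpow_Suc_right del: funpow.simps)
  qed
qed simp

text \<open>Otherwise the difference would have infinitely many roots. This also gives the
  uniqueness behind \<open>ehrhart_poly\<close>.\<close>

lemma poly_eq_of_nat_points:
  fixes p q :: "real poly"
  assumes "\<And>j::nat. poly p (real j) = poly q (real j)"
  shows "p = q"
proof (rule ccontr)
  assume "p \<noteq> q"
  then have "finite {x. poly (p - q) x = 0}" by (intro poly_roots_finite) simp
  moreover have "range real \<subseteq> {x. poly (p - q) x = 0}" using assms by auto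
  ultimately have "finite (range real)" by (rule rev_finite_subset)
  then show False using finite_imageD inj_of_nat infinite_UNIV_nat by blast
qed

section \<open>Binomial polynomials and the map \<open>binom_to_monom\<close>\<close>

lemma poly_binom_poly: "poly (binom_poly m) x = x gchoose m"
  by (simp add: binom_poly_def gbinomial_prod_rev poly_prod atLeast0LessThan)

lemma fwd_diff_binom_poly_0: "fwd_diff (binom_poly 0) = 0"
  by (simp add: fwd_diff_def binom_poly_def)

lemma fwd_diff_binom_poly_Suc: "fwd_diff (binom_poly (Suc m)) = binom_poly m"
  by (rule poly_eq_of_nat_points)
    (simp add: poly_fwd_diff poly_binom_poly gbinomial_Suc_Suc)

text \<open>By Pascal's rule a difference lowers the index by one, so iterated differences at 0 form
  the dual basis.\<close>

lemma fwd_diff_iter_binom_poly: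
  "poly ((fwd_diff ^^ j) (binom_poly m)) 0 = (if j = m then 1 else 0)"
proof (induction j arbitrary: m)
  case 0
  show ?case by (cases m) (simp_all add: poly_binom_poly)
next
  case (Suc j)
  have "(fwd_diff ^^ j) 0 = 0"
    by (induction j) (simp_all add: fwd_diff_def)
  with Suc show ?case
    by (cases m) (simp_all add: funpow_Suc_right fwd_diff_binom_poly_0
        fwd_diff_binom_poly_Suc del: funpow.simps)
qed

lemma degree_binom_poly: "degree (binom_poly m) = m"
  and lead_coeff_binom_poly: "lead_coeff (binom_poly m) = 1 / fact m"
proof -
  have "degree (\<Prod>i<m. [:- real i, 1:]) = m"
    by (subst degree_prod_eq_sum_degree) auto
  then show "degree (binom_poly m) = m" by (simp add: binom_poly_def)
  have "lead_coeff (\<Prod>i<m. [:- real i, 1:]) = 1"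
    by (simp add: lead_coeff_prod)
  then show "lead_coeff (binom_poly m) = 1 / fact m"
    by (simp add: binom_poly_def lead_coeff_smult)
qed

text \<open>The binomial polynomials span: the leading term of p is removed by a multiple of
  \<open>binom_poly (degree p)\<close>, where the factorial cancels the leading coefficient
  1/n!.\<close>

lemma poly_binom_induct [case_names zero step]:
  assumes "P 0"
    and "\<And>c m p. P p \<Longrightarrow> P (p + smult c (binom_poly m))"
  shows "P p"
proof (induction "degree p" arbitrary: p rule: less_induct)
  case less
  let ?n = "degree p"
  let ?b = "smult (lead_coeff p * fact ?n) (binom_poly ?n)"
  have lc: "coeff ?b ?n = lead_coeff p"
    using lead_coeff_binom_poly[of ?n] by (simp add: degree_binom_poly)
  show ?case
  proof (cases "?n = 0")
    \<comment> \<open>Subtraction cannot lower degree 0, so constants are handled directly.\<close>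
    case True
    then obtain c where "p = [:c:]" by (elim degree_eq_zeroE)
    then have "p = 0 + smult c (binom_poly 0)" by (simp add: binom_poly_def)
    then show ?thesis using assms by metis
  next
    case False
    then have "p \<noteq> 0" by auto
    then have deg: "degree ?b = ?n" by (simp add: degree_binom_poly)
    then have "degree (p - ?b) < degree p"
      using False lc by (intro degree_diff_lt) auto
    then have "P (p - ?b)" by (rule less)
    then have "P (p - ?b + ?b)" by (rule assms(2))
    then show ?thesis by simp
  qed
qed

text \<open>The map with these coefficients satisfies the three conditions, and any other such map
  agrees with it by induction over the binomial basis.\<close>

lemma coeff_binom_to_monom: "coeff (binom_to_monom p) j = poly ((fwd_diff ^^ j) p) 0"
proof -
  define L where "L p = Abs_poly (\<lambda>j. poly ((fwd_diff ^^ j) p) 0)" for p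
  have L: "coeff (L p) j = poly ((fwd_diff ^^ j) p) 0" for p j
    unfolding L_def
    by (subst coeff_Abs_poly[of "degree p"]) (simp_all add: fwd_diff_iter_eq_0)
  have "binom_to_monom = L"
    unfolding binom_to_monom_def
  proof (rule the_equality)
    show "(\<forall>p q. L (p + q) = L p + L q) \<and> (\<forall>c p. L (smult c p) = smult c (L p)) \<and>
      (\<forall>j. L (binom_poly j) = monom 1 j)"
      by (auto simp: poly_eq_iff L fwd_diff_iter_add fwd_diff_iter_smult
          fwd_diff_iter_binom_poly)
    fix M :: "real poly \<Rightarrow> real poly"
    assume M: "(\<forall>p q. M (p + q) = M p + M q) \<and> (\<forall>c p. M (smult c p) = smult c (M p)) \<and>
      (\<forall>j. M (binom_poly j) = monom 1 j)"
    show "M = L"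
    proof
      fix p
      show "M p = L p"
      proof (induction p rule: poly_binom_induct)
        case zero
        have "M (smult 0 0) = smult 0 (M 0)" using M by blast
        moreover have "L (smult 0 0) = smult 0 (L 0)"
          by (simp only: poly_eq_iff L fwd_diff_iter_smult coeff_smult poly_smult) simp
        ultimately show ?case by simp
      next
        case (step c m p)
        have "L (p + smult c (binom_poly m)) = L p + smult c (monom 1 m)"
          by (auto simp: poly_eq_iff L fwd_diff_iter_add fwd_diff_iter_smult
              fwd_diff_iter_binom_poly)
        with M step show ?case by simp
      qed
    qed
  qed
  with L show ?thesis by simp
qed


section \<open>Ehrhart and $h^*$-polynomials\<close>

lemma ehrhart_polyI:
  assumes "\<And>j. real (lattice_count Q j) = poly E (real j)"
  shows "ehrhart_poly Q = E"
  unfolding ehrhart_poly_def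
  using assms by (intro the_equality) (auto intro: poly_eq_of_nat_points)

text \<open>Multiplying the series by 1 - X replaces p by its backward difference up to a constant,
  so n factors reduce it to a polynomial.\<close>

lemma poly_fps_times_one_minus_X_power:
  fixes p :: "real poly"
  assumes "degree p < n"
  shows "\<exists>h. Abs_fps (\<lambda>j. poly p (real j)) * (1 - fps_X) ^ n = fps_of_poly h"
  using assms
proof (induction n arbitrary: p)
  case (Suc n)
  let ?F = "\<lambda>p. Abs_fps (\<lambda>j. poly p (real j))"
  define q where "q = p - pcompose p [:-1, 1:]"
  \<comment> \<open>At index 0 the left side is p(0), while q(0) = p(0) - p(-1); the constant p(-1)
    makes up for this.\<close>
  have eq: "?F p * (1 - fps_X) = ?F q + fps_of_poly [:poly p (-1):]"
  proof (rule fps_ext)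
    fix j
    show "fps_nth (?F p * (1 - fps_X)) j = fps_nth (?F q + fps_of_poly [:poly p (-1):]) j"
      by (cases j) (auto simp: algebra_simps q_def poly_pcompose fps_of_poly_const)
  qed
  have "\<exists>h. ?F q * (1 - fps_X) ^ n = fps_of_poly h"
  proof (cases "degree p = 0")
    \<comment> \<open>For constant p and n = 0 the bound required by the induction hypothesis fails,
      but q vanishes.\<close>
    case True
    then obtain c where "p = [:c:]" by (elim degree_eq_zeroE)
    then have "q = 0" by (simp add: q_def)
    then have "?F q * (1 - fps_X) ^ n = fps_of_poly 0"
      by (simp add: fps_zero_def[symmetric])
    then show ?thesis by blast
  next
    case False
    have "degree q = degree (pcompose p [:-1, 1:] - p)"
      unfolding q_def by (metis degree_minus minus_diff_eq)
    also have "\<dots> < degree p" using False by (intro degree_shift_diff_lt) simp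
    finally show ?thesis using Suc by simp
  qed
  then obtain h where h: "?F q * (1 - fps_X) ^ n = fps_of_poly h" by blast
  have "?F p * (1 - fps_X) ^ Suc n = (?F p * (1 - fps_X)) * (1 - fps_X) ^ n"
    by (simp add: mult_ac)
  also have "\<dots> = fps_of_poly (h + [:poly p (-1):] * [:1, -1:] ^ n)"
    unfolding eq
    by (simp add: distrib_right h fps_of_poly_add fps_of_poly_mult fps_of_poly_power
        fps_of_poly_linear fps_of_poly_pCons)
  finally show ?case by blast
qed simp

text \<open>The degree bound ensures that a polynomial numerator exists. It is unique because the
  power of 1 - X is a unit, so the quotient can be cleared.\<close>

lemma fps_of_poly_hstar_poly:
  assumes "degree (ehrhart_poly Q) < nat (aff_dim Q + 1)"
  shows "fps_of_poly (hstar_poly Q) =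
    Abs_fps (\<lambda>j. poly (ehrhart_poly Q) (real j)) * (1 - fps_X) ^ nat (aff_dim Q + 1)"
proof -
  let ?n = "nat (aff_dim Q + 1)"
  let ?F = "Abs_fps (\<lambda>j. poly (ehrhart_poly Q) (real j))"
  let ?U = "(1 - fps_X :: real fps) ^ ?n"
  have unit: "fps_nth ?U 0 \<noteq> 0" by (simp add: fps_power_zeroth)
  have iff: "?F = fps_of_poly h / ?U \<longleftrightarrow> ?F * ?U = fps_of_poly h" for h
  proof
    assume "?F = fps_of_poly h / ?U"
    then show "?F * ?U = fps_of_poly h"
      using unit by (simp add: fps_divide_unit mult.assoc inverse_mult_eq_1)
  next
    assume "?F * ?U = fps_of_poly h"
    then have "fps_of_poly h / ?U = ?F * (?U * inverse ?U)"
      using unit by (simp add: fps_divide_unit mult.assoc)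
    then show "?F = fps_of_poly h / ?U"
      using unit by (simp add: inverse_mult_eq_1')
  qed
  obtain h where h: "?F * ?U = fps_of_poly h"
    using poly_fps_times_one_minus_X_power[OF assms] by blast
  have "hstar_poly Q = h"
    unfolding hstar_poly_def iff
    using h by (intro the_equality) (simp_all add: fps_of_poly_eq_iff)
  with h show ?thesis by simp
qed

lemma fps_nth_one_minus_X_power:
  fixes n :: nat
  shows "fps_nth ((1 - fps_X :: real fps) ^ n) 0 = 1"
    and "fps_nth ((1 - fps_X :: real fps) ^ n) 1 = - real n"
    and "fps_nth ((1 - fps_X :: real fps) ^ n) 2 = real n * (real n - 1) / 2"
proof -
  let ?U = "\<lambda>n. (1 - fps_X :: real fps) ^ n"
  \<comment> \<open>This is Pascal's rule with signs; the three coefficients follow by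
    induction.\<close>
  have step: "fps_nth (?U (Suc n)) (Suc j) = fps_nth (?U n) (Suc j) - fps_nth (?U n) j" for n j
    by (simp add: algebra_simps)
  show 0: "fps_nth (?U n) 0 = 1" for n by (simp add: fps_power_zeroth)
  have 1: "fps_nth (?U n) (Suc 0) = - real n" for n
    by (induction n) (simp_all only: step 0, simp_all)
  then show "fps_nth (?U n) 1 = - real n" by simp
  have "fps_nth (?U n) (Suc (Suc 0)) = real n * (real n - 1) / 2" for n
    by (induction n) (simp_all only: step 1, simp_all add: field_simps)
  then show "fps_nth (?U n) 2 = real n * (real n - 1) / 2" by (simp add: numeral_2_eq_2)
qed

lemma coeff_hstar_poly:
  assumes "degree (ehrhart_poly Q) < n" "n = nat (aff_dim Q + 1)"
  defines "E \<equiv> \<lambda>j::nat. poly (ehrhart_poly Q) (real j)"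
  shows "coeff (hstar_poly Q) 0 = E 0"
    and "coeff (hstar_poly Q) 1 = E 1 - real n * E 0"
    and "coeff (hstar_poly Q) 2 = E 2 - real n * E 1 + real n * (real n - 1) / 2 * E 0"
proof -
  have c: "coeff (hstar_poly Q) j = (\<Sum>i=0..j. E i * fps_nth ((1 - fps_X) ^ n) (j - i))" for j
    using fps_of_poly_hstar_poly[of Q] assms
    by (metis (no_types, lifting) fps_mult_nth fps_nth_Abs_fps fps_of_poly_nth sum.cong)
  note U = fps_nth_one_minus_X_power[of n]
  show "coeff (hstar_poly Q) 0 = E 0" by (simp add: c U)
  show "coeff (hstar_poly Q) 1 = E 1 - real n * E 0"
    using U by (simp add: c)
  have "{0..2::nat} = {0, 1, 2}" by auto
  then show "coeff (hstar_poly Q) 2 = E 2 - real n * E 1 + real n * (real n - 1) / 2 * E 0"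
    using U by (simp add: c)
qed


section \<open>Real-rooted polynomials\<close>

text \<open>With $p = \prod_i (1 + a_i x)$ the difference of the two sides is $\sum_i a_i^2$.\<close>

lemma real_rooted_coeff_ineq:
  assumes "real_rooted p" "coeff p 0 = 1"
  shows "2 * coeff p 2 \<le> (coeff p 1)\<^sup>2"
  using assms
proof (induction "degree p" arbitrary: p rule: less_induct)
  case less
  let ?c = "map_poly complex_of_real"
  have "p \<noteq> 0" using less.prems by auto
  show ?case
  proof (cases "degree p = 0")
    case True
    then show ?thesis by (simp add: coeff_eq_0)
  next
    case False
    then have "degree (?c p) \<noteq> 0" by (simp add: degree_map_poly)
    then have "\<not> constant (poly (?c p))" by (simp add: constant_degree)
    then obtain z where z: "poly (?c p) z = 0" using fundamental_theorem_of_algebra by blast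
    then have "z \<in> \<real>" using less.prems \<open>p \<noteq> 0\<close> by (auto simp: real_rooted_def)
    then obtain r where r: "z = of_real r" by (elim Reals_cases)
    have "poly (?c p) (of_real r) = of_real (poly p r)" by (induction p) (simp_all add: map_poly_pCons)
    then have "poly p r = 0" using z by (simp add: r)
    have "r \<noteq> 0" using \<open>poly p r = 0\<close> less.prems(2) by (auto simp: poly_0_coeff_0)
    obtain g where g: "p = [:- r, 1:] * g"
      using \<open>poly p r = 0\<close> by (auto simp: poly_eq_0_iff_dvd elim: dvdE)
    \<comment> \<open>The root factor is rescaled to constant term 1, so that q again has constant
      term 1 and the induction applies.\<close>
    define a where "a = - 1 / r"
    define q where "q = smult (- r) g"
    have "[:- r, 1:] = smult (- r) [:1, a:]" using \<open>r \<noteq> 0\<close> by (simp add: a_def)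
    then have p: "p = [:1, a:] * q"
      unfolding g q_def by (simp only: mult_smult_left mult_smult_right)
    have "q \<noteq> 0" using p \<open>p \<noteq> 0\<close> by auto
    have "a \<noteq> 0" using \<open>r \<noteq> 0\<close> by (simp add: a_def)
    have "degree p = Suc (degree q)"
      unfolding p using \<open>q \<noteq> 0\<close> \<open>a \<noteq> 0\<close> by (subst degree_mult_eq) auto
    moreover have "real_rooted q"
      unfolding real_rooted_def
    proof (intro disjI2 allI impI)
      fix w assume "poly (?c q) w = 0"
      moreover have "?c p = ?c [:1, a:] * ?c q"
        unfolding p by (intro poly_eqI) (simp add: coeff_map_poly coeff_mult del: mult_pCons_left)
      ultimately have "poly (?c p) w = 0" by simp
      then show "w \<in> \<real>" using less.prems \<open>p \<noteq> 0\<close> by (auto simp: real_rooted_def)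
    qed
    moreover have "coeff q 0 = 1" using less.prems(2) by (simp add: p)
    ultimately have "2 * coeff q 2 \<le> (coeff q 1)\<^sup>2" using less.hyps by simp
    \<comment> \<open>Passing from q to p increases (coefficient 1)^2 - 2 (coefficient 2) by exactly
      a^2.\<close>
    moreover have "coeff p 1 = coeff q 1 + a" "coeff p 2 = coeff q 2 + a * coeff q 1"
      using \<open>coeff q 0 = 1\<close> by (simp_all add: p numeral_2_eq_2)
    moreover have "0 \<le> a\<^sup>2" by simp
    ultimately show ?thesis by (simp add: power2_eq_square algebra_simps del: zero_le_square)
  qed
qed


section \<open>Cartesian powers\<close>

text \<open>Splitting a point into its blocks identifies the lattice points of the dilated power
  with functions from \<open>'k\<close> to those of the dilate of Q.\<close>

lemma lattice_count_cart_power: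
  fixes Q :: "(real ^ 'n) set"
  shows "lattice_count (cart_power Q :: (real ^ ('k::finite \<times> 'n)) set) j
    = lattice_count Q j ^ CARD('k)"
proof -
  let ?A = "(\<lambda>x. real j *\<^sub>R x) ` Q \<inter> int_lattice"
  let ?B = "(\<lambda>x. real j *\<^sub>R x) ` cart_power Q \<inter> int_lattice :: (real ^ ('k \<times> 'n)) set"
  let ?f = "\<lambda>(x :: real ^ ('k \<times> 'n)) i. \<chi> l. x $ (i, l)"
  have "bij_betw ?f ?B ((UNIV :: 'k set) \<rightarrow> ?A)"
  proof (rule bij_betw_byWitness[where f' = "\<lambda>g. \<chi> p. g (fst p) $ snd p"])
    show "?f ` ?B \<subseteq> UNIV \<rightarrow> ?A"
    proof clarify
      fix x :: "real ^ ('k \<times> 'n)" and i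
      assume x: "x \<in> cart_power Q" "real j *\<^sub>R x \<in> int_lattice"
      have "(\<chi> l. (real j *\<^sub>R x) $ (i, l)) = real j *\<^sub>R (\<chi> l. x $ (i, l))"
        by (simp add: vec_eq_iff)
      with x show "(\<chi> l. (real j *\<^sub>R x) $ (i, l)) \<in> ?A"
        by (auto simp: cart_power_def int_lattice_def)
    qed
    show "(\<lambda>g. \<chi> p. g (fst p) $ snd p) ` ((UNIV :: 'k set) \<rightarrow> ?A) \<subseteq> ?B"
    proof clarify
      fix g :: "'k \<Rightarrow> real ^ 'n"
      assume g: "g \<in> UNIV \<rightarrow> ?A"
      \<comment> \<open>A preimage is chosen in each block, which also covers j = 0, where dilation
        is not invertible.\<close>
      then have "\<forall>i. \<exists>y\<in>Q. g i = real j *\<^sub>R y" by auto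
      then obtain y where y: "\<And>i. y i \<in> Q" "\<And>i. g i = real j *\<^sub>R y i" by metis
      have "(\<chi> p. y (fst p) $ snd p) \<in> cart_power Q"
        using y by (simp add: cart_power_def)
      moreover have "(\<chi> p. g (fst p) $ snd p) = real j *\<^sub>R (\<chi> p. y (fst p) $ snd p)"
        using y by (simp add: vec_eq_iff)
      moreover have "(\<chi> p. g (fst p) $ snd p) \<in> int_lattice"
        using g by (auto simp: int_lattice_def Pi_iff)
      ultimately show "(\<chi> p. g (fst p) $ snd p) \<in> ?B" by blast
    qed
  qed (auto simp: vec_eq_iff)
  then have "card ?B = card ((UNIV :: 'k set) \<rightarrow> ?A)" by (rule bij_betw_same_card)
  also have "\<dots> = card ?A ^ CARD('k)"
    using card_PiE[of "UNIV :: 'k set" "\<lambda>_. ?A"] by (simp add: PiE_UNIV_domain)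
  finally show ?thesis by (simp add: lattice_count_def)
qed


section \<open>The tetrahedron\<close>

text \<open>The four inequalities say that 8 times each barycentric coordinate is nonnegative. The
  vertices satisfy them, and conversely those coordinates write a point as a convex
  combination.\<close>

lemma tetra_eq:
  "tetra = {x. 0 \<le> x $ 3 \<and> x $ 3 \<le> 8 * x $ 1 \<and> 7 * x $ 3 \<le> 8 * x $ 2 \<and>
    8 * x $ 1 + 8 * x $ 2 - 7 * x $ 3 \<le> 8}"
  (is "_ = ?H")
proof
  have "convex ?H"
  proof (rule convexI)
    fix x y :: "real ^ 3" and u v :: real
    assume "x \<in> ?H" "y \<in> ?H" and uv: "0 \<le> u" "0 \<le> v" "u + v = 1"
    then have "0 \<le> u * x $ 3" "0 \<le> v * y $ 3"
      "0 \<le> u * (8 * x $ 1 - x $ 3)" "0 \<le> v * (8 * y $ 1 - y $ 3)"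
      "0 \<le> u * (8 * x $ 2 - 7 * x $ 3)" "0 \<le> v * (8 * y $ 2 - 7 * y $ 3)"
      "0 \<le> u * (8 - (8 * x $ 1 + 8 * x $ 2 - 7 * x $ 3))"
      "0 \<le> v * (8 - (8 * y $ 1 + 8 * y $ 2 - 7 * y $ 3))"
      by simp_all
    then show "u *\<^sub>R x + v *\<^sub>R y \<in> ?H"
      using uv(3) by (simp add: algebra_simps)
  qed
  then show "tetra \<subseteq> ?H"
    unfolding tetra_def by (intro hull_minimal) (auto simp: vector_3)
  show "?H \<subseteq> tetra"
  proof
    fix x assume x: "x \<in> ?H"
    let ?V = "{vector [0, 0, 0], vector [1, 0, 0], vector [0, 1, 0], vector [1, 7, 8]}
      :: (real ^ 3) set"
    \<comment> \<open>Solving x = a (1,0,0) + b (0,1,0) + c (1,7,8) from the last coordinate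
      upwards.\<close>
    define c where "c = x $ 3 / 8"
    define a where "a = x $ 1 - c"
    define b where "b = x $ 2 - 7 * c"
    define w where "w = (\<lambda>i::nat. [1 - a - b - c, a, b, c] ! i)"
    define v where "v = (\<lambda>i::nat. [vector [0, 0, 0], vector [1, 0, 0], vector [0, 1, 0],
      vector [1, 7, 8] :: real ^ 3] ! i)"
    have I: "{..<4::nat} = {0, 1, 2, 3}" by auto
    have "(\<Sum>i<4. w i *\<^sub>R v i) \<in> convex hull ?V"
    proof (rule convex_sum)
      show "sum w {..<4} = 1" by (simp add: I w_def)
      fix i assume "i \<in> {..<4::nat}"
      then have i: "i \<in> {0, 1, 2, 3}" by (simp only: I)
      then show "0 \<le> w i" using x by (auto simp: w_def a_def b_def c_def)
      have "v i \<in> ?V" using i by (auto simp: v_def)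
      then show "v i \<in> convex hull ?V" by (rule hull_inc)
    qed auto
    moreover have "(\<Sum>i<4. w i *\<^sub>R v i) = x"
      by (simp add: I w_def v_def vec_eq_iff forall_3 vector_3 a_def b_def c_def)
    ultimately show "x \<in> tetra" by (simp add: tetra_def)
  qed
qed

lemma dilated_tetra_eq:
  "(\<lambda>x. real j *\<^sub>R x) ` tetra = {x. 0 \<le> x $ 3 \<and> x $ 3 \<le> 8 * x $ 1 \<and> 7 * x $ 3 \<le> 8 * x $ 2 \<and>
    8 * x $ 1 + 8 * x $ 2 - 7 * x $ 3 \<le> 8 * real j}"
  (is "_ = ?H")
proof (cases "j = 0")
  case True
  have "0 \<in> tetra" by (simp add: tetra_eq)
  \<comment> \<open>The middle inequalities give \<open>8 * x $ 1 + 8 * x $ 2\<close> >=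
    \<open>8 * x $ 3\<close>; with the last one \<open>x $ 3\<close> is 0, and then so are the
    others.\<close>
  moreover have "x = 0" if "x \<in> ?H" for x
    using that True by (simp add: vec_eq_iff forall_3)
  ultimately show ?thesis using True by (auto simp: image_constant_conv)
next
  case False
  show ?thesis
  proof
    show "(\<lambda>x. real j *\<^sub>R x) ` tetra \<subseteq> ?H"
    proof clarify
      fix x :: "real ^ 3" assume "x \<in> tetra"
      then have "0 \<le> real j * x $ 3" "0 \<le> real j * (8 * x $ 1 - x $ 3)"
        "0 \<le> real j * (8 * x $ 2 - 7 * x $ 3)"
        "0 \<le> real j * (8 - (8 * x $ 1 + 8 * x $ 2 - 7 * x $ 3))"
        by (simp_all add: tetra_eq)
      then show "0 \<le> (real j *\<^sub>R x) $ 3 \<and> (real j *\<^sub>R x) $ 3 \<le> 8 * (real j *\<^sub>R x) $ 1 \<and>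
        7 * (real j *\<^sub>R x) $ 3 \<le> 8 * (real j *\<^sub>R x) $ 2 \<and>
        8 * (real j *\<^sub>R x) $ 1 + 8 * (real j *\<^sub>R x) $ 2 - 7 * (real j *\<^sub>R x) $ 3 \<le> 8 * real j"
        by (simp add: algebra_simps)
    qed
    show "?H \<subseteq> (\<lambda>x. real j *\<^sub>R x) ` tetra"
    proof
      fix x assume "x \<in> ?H"
      define t where "t = 1 / real j"
      have t: "0 \<le> t" "t * real j = 1" using False by (simp_all add: t_def)
      with \<open>x \<in> ?H\<close> have "0 \<le> t * x $ 3" "0 \<le> t * (8 * x $ 1 - x $ 3)"
        "0 \<le> t * (8 * x $ 2 - 7 * x $ 3)"
        "0 \<le> t * (8 * real j - (8 * x $ 1 + 8 * x $ 2 - 7 * x $ 3))"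
        by simp_all
      moreover have "t * (real j * 8) = 8" using t(2) by (simp add: mult.assoc[symmetric])
      ultimately have "t *\<^sub>R x \<in> tetra" by (simp add: tetra_eq algebra_simps)
      moreover have "x = real j *\<^sub>R (t *\<^sub>R x)" using t(2) by (simp add: mult.commute)
      ultimately show "x \<in> (\<lambda>x. real j *\<^sub>R x) ` tetra" by blast
    qed
  qed
qed

section \<open>Counting the lattice points of the dilates\<close>

definition tetra_points :: "nat \<Rightarrow> (int \<times> int \<times> int) set" where
  "tetra_points j = {(x, y, z). 0 \<le> z \<and> z \<le> 8 * x \<and> 7 * z \<le> 8 * y \<and>
    8 * x + 8 * y - 7 * z \<le> 8 * int j}"

lemma lattice_count_tetra: "lattice_count tetra j = card (tetra_points j)"
proof -
  let ?f = "\<lambda>(x, y, z). vector [of_int x, of_int y, of_int z] :: real ^ 3"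
  have "inj ?f"
    by (auto simp: inj_def vec_eq_iff forall_3 vector_3)
  moreover have "?f ` tetra_points j = (\<lambda>x. real j *\<^sub>R x) ` tetra \<inter> int_lattice"
  proof (intro equalityI subsetI)
    fix v assume "v \<in> ?f ` tetra_points j"
    then obtain x y z where v: "v = vector [of_int x, of_int y, of_int z]"
      and "0 \<le> z" "z \<le> 8 * x" "7 * z \<le> 8 * y" "8 * x + 8 * y - 7 * z \<le> 8 * int j"
      by (auto simp: tetra_points_def)
    then have "0 \<le> real_of_int z" "real_of_int z \<le> 8 * of_int x"
      "7 * real_of_int z \<le> 8 * of_int y"
      "8 * real_of_int x + 8 * of_int y - 7 * of_int z \<le> 8 * real j"
      by linarith+
    then show "v \<in> (\<lambda>x. real j *\<^sub>R x) ` tetra \<inter> int_lattice"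
      by (simp add: dilated_tetra_eq int_lattice_def forall_3 vector_3 v)
  next
    fix v :: "real ^ 3" assume v: "v \<in> (\<lambda>x. real j *\<^sub>R x) ` tetra \<inter> int_lattice"
    then have "v $ 1 \<in> \<int>" "v $ 2 \<in> \<int>" "v $ 3 \<in> \<int>" by (auto simp: int_lattice_def)
    then obtain x y z where xyz: "v $ 1 = of_int x" "v $ 2 = of_int y" "v $ 3 = of_int z"
      by (metis Ints_cases)
    have "0 \<le> real_of_int z" "real_of_int z \<le> 8 * of_int x"
      "7 * real_of_int z \<le> 8 * of_int y"
      "8 * real_of_int x + 8 * of_int y - 7 * of_int z \<le> 8 * real j"
      using v by (simp_all add: dilated_tetra_eq xyz)
    then have "(x, y, z) \<in> tetra_points j"
      unfolding tetra_points_def mem_Collect_eq prod.case by (intro conjI; linarith)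
    moreover have "v = ?f (x, y, z)"
      by (simp add: vec_eq_iff forall_3 vector_3 xyz)
    ultimately show "v \<in> ?f ` tetra_points j" by blast
  qed
  ultimately show ?thesis
    unfolding lattice_count_def using card_image[of ?f "tetra_points j"]
    by (simp add: inj_on_subset)
qed

text \<open>With the strict bound, n is the number of lattice points on a leg, and n = 0 gives the
  empty slices needed for j = 0 below.\<close>

definition triangle_points :: "nat \<Rightarrow> (nat \<times> nat) set" where
  "triangle_points n = {(a, b). a + b < n}"

lemma finite_triangle_points: "finite (triangle_points n)"
  and card_triangle_points: "real (card (triangle_points n)) = real n * (real n + 1) / 2"
proof -
  have eq: "triangle_points n = (SIGMA a:{..<n}. {..<n - a})"
    by (auto simp: triangle_points_def)
  show "finite (triangle_points n)" by (simp add: eq)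
  have "card (triangle_points n) = (\<Sum>a<n. n - a)" by (simp add: eq)
  also have "\<dots> = (\<Sum>a<n. Suc a)"
    by (rule sum.reindex_bij_witness[where i = "\<lambda>a. n - Suc a" and j = "\<lambda>a. n - Suc a"]) auto
  finally have "card (triangle_points n) = (\<Sum>a<n. Suc a)" .
  moreover have "real (\<Sum>a<n. Suc a) = real n * (real n + 1) / 2"
    by (induction n) (simp_all add: field_simps)
  ultimately show "real (card (triangle_points n)) = real n * (real n + 1) / 2" by simp
qed

text \<open>Translation by the vertex $(1,7,8)$ maps the $j$-th dilate onto the part of the next one
  above height 8. Below it, the slice at height 0 is a triangle with legs $j + 1$ and each of the
  slices at heights 1 to 7 contains the lattice points of a triangle with legs $j - 1$.\<close>

lemma tetra_points_Suc:
  "tetra_points (Suc j) = (\<lambda>(x, y, z). (x + 1, y + 7, z + 8)) ` tetra_points j \<union>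
    ((\<lambda>(a, b). (int a, int b, 0)) ` triangle_points (j + 2) \<union>
     (\<lambda>(r, a, b). (int a + 1, int b + r, r)) ` ({1..7} \<times> triangle_points j))"
  (is "_ = ?S \<union> (?T \<union> ?U)")
proof (intro equalityI subsetI)
  fix p assume "p \<in> tetra_points (Suc j)"
  then obtain x y z where p: "p = (x, y, z)" and
    xyz: "0 \<le> z" "z \<le> 8 * x" "7 * z \<le> 8 * y" "8 * x + 8 * y - 7 * z \<le> 8 * int j + 8"
    by (auto simp: tetra_points_def)
  consider "z \<ge> 8" | "z = 0" | "1 \<le> z" "z \<le> 7" using xyz by linarith
  then show "p \<in> ?S \<union> (?T \<union> ?U)"
  proof cases
    case 1
    with xyz have "(x - 1, y - 7, z - 8) \<in> tetra_points j"
      by (simp add: tetra_points_def)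
    then have "p \<in> ?S" by (force simp: p)
    then show ?thesis by blast
  next
    case 2
    with xyz have "(nat x, nat y) \<in> triangle_points (j + 2)"
      by (simp add: triangle_points_def)
    moreover have "p = (\<lambda>(a, b). (int a, int b, 0)) (nat x, nat y)"
      using 2 xyz by (simp add: p)
    ultimately have "p \<in> ?T" by blast
    then show ?thesis by blast
  next
    case 3
    \<comment> \<open>For 1 <= z <= 7 the number 7z/8 lies strictly between z - 1 and z, so the
      inequalities round to these integer bounds.\<close>
    with xyz have "1 \<le> x" "z \<le> y" "x + y \<le> int j + z" by linarith+
    then have "(z, nat (x - 1), nat (y - z)) \<in> {1..7} \<times> triangle_points j"
      using 3 unfolding triangle_points_def mem_Sigma_iff mem_Collect_eq prod.case by auto
    moreover have "p = (\<lambda>(r, a, b). (int a + 1, int b + r, r)) (z, nat (x - 1), nat (y - z))"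
      using \<open>1 \<le> x\<close> \<open>z \<le> y\<close> by (simp add: p)
    ultimately have "p \<in> ?U" by blast
    then show ?thesis by blast
  qed
qed (auto simp: tetra_points_def triangle_points_def)

text \<open>The decomposition gives a recurrence with increment T(j + 2) + 7 T(j), where T(n) = n (n
  + 1) / 2; this cubic solves it. Its leading coefficient 4/3 is the volume 8/6.\<close>

lemma finite_tetra_points: "finite (tetra_points j)"
  and card_tetra_points:
    "real (card (tetra_points j)) = (real j + 1) * (4 * (real j)\<^sup>2 - real j + 3) / 3"
proof (induction j)
  case 0
  have "tetra_points 0 = {(0, 0, 0)}" by (auto simp: tetra_points_def)
  then show "finite (tetra_points 0)"
    "real (card (tetra_points 0)) = (real 0 + 1) * (4 * (real 0)\<^sup>2 - real 0 + 3) / 3"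
    by simp_all
next
  case (Suc j)
  let ?f = "\<lambda>(x, y, z). (x + 1, y + 7, z + 8) :: int \<times> int \<times> int"
  let ?g = "\<lambda>(a, b). (int a, int b, 0 :: int)"
  let ?h = "\<lambda>(r, a, b). (int a + 1, int b + r, r)"
  let ?S = "?f ` tetra_points j" and ?T = "?g ` triangle_points (j + 2)"
    and ?U = "?h ` ({1..7} \<times> triangle_points j)"
  have fin: "finite ?S" "finite ?T" "finite ?U"
    using Suc finite_triangle_points by auto
  then show "finite (tetra_points (Suc j))" by (simp add: tetra_points_Suc)
  \<comment> \<open>The pieces are separated by height: at least 8, equal to 0, and 1 to 7.\<close>
  have "?S \<inter> (?T \<union> ?U) = {}" "?T \<inter> ?U = {}"
    by (auto simp: tetra_points_def)
  then have "card (tetra_points (Suc j)) = card ?S + (card ?T + card ?U)"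
    using fin by (simp add: tetra_points_Suc card_Un_disjoint)
  moreover have "card ?S = card (tetra_points j)"
    by (intro card_image) (auto simp: inj_on_def)
  moreover have "card ?T = card (triangle_points (j + 2))"
    by (intro card_image) (auto simp: inj_on_def)
  moreover have "card ?U = card ({1..7::int} \<times> triangle_points j)"
    by (intro card_image) (auto simp: inj_on_def)
  ultimately have "real (card (tetra_points (Suc j))) = real (card (tetra_points j)) +
    real (card (triangle_points (j + 2))) + 7 * real (card (triangle_points j))"
    by (simp add: card_cartesian_product)
  then show "real (card (tetra_points (Suc j))) =
      (real (Suc j) + 1) * (4 * (real (Suc j))\<^sup>2 - real (Suc j) + 3) / 3"
    unfolding Suc.IH(2) card_triangle_points by (simp add: field_simps power2_eq_square)
qed

section \<open>Cartesian powers of the tetrahedron and the conclusion\<close>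

lemma ehrhart_poly_cart_power_tetra:
  "ehrhart_poly (cart_power tetra :: (real ^ ('k::finite \<times> 3)) set) =
    (smult (1 / 3) ([:1, 1:] * [:3, -1, 4:])) ^ CARD('k)"
  by (rule ehrhart_polyI)
    (simp add: lattice_count_cart_power lattice_count_tetra card_tetra_points poly_power
      power2_eq_square field_simps)

text \<open>An interior point forces full dimension. The point (1/4, 1/4, 1/8) in every block
  satisfies all facet inequalities strictly, and these define an open set.\<close>

lemma aff_dim_cart_power_tetra:
  "aff_dim (cart_power tetra :: (real ^ ('k::finite \<times> 3)) set) = 3 * int CARD('k)"
proof -
  let ?P = "cart_power tetra :: (real ^ ('k \<times> 3)) set"
  let ?U = "{x :: real ^ ('k \<times> 3). \<forall>i. 0 < x $ (i, 3) \<and> x $ (i, 3) < 8 * x $ (i, 1) \<and>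
    7 * x $ (i, 3) < 8 * x $ (i, 2) \<and> 8 * x $ (i, 1) + 8 * x $ (i, 2) - 7 * x $ (i, 3) < 8}"
  have "(\<chi> p. if snd p = 3 then 1 / 8 else 1 / 4) \<in> interior ?P"
  proof (rule interiorI)
    show "open ?U"
      unfolding Collect_all_eq
      by (intro open_INT finite ballI open_Collect_conj open_Collect_less continuous_intros)
    show "(\<chi> p. if snd p = 3 then 1 / 8 else 1 / 4) \<in> ?U" by simp
    show "?U \<subseteq> ?P" by (auto simp: cart_power_def tetra_eq less_imp_le)
  qed
  then have "interior ?P \<noteq> {}" by blast
  then show ?thesis by (simp add: aff_dim_nonempty_interior)
qed

theorem theorem5p1:
  fixes Pk :: "(real ^ ('k::finite \<times> 3)) set"
  assumes "Pk = cart_power tetra"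
  shows "(coeff (f_poly Pk) 1)\<^sup>2 < coeff (f_poly Pk) 0 * coeff (f_poly Pk) 2 \<and>
         \<not> log_concave (hstar_poly Pk) \<and>
         \<not> real_rooted (hstar_poly Pk)"
proof -
  define k where "k = CARD('k)"
  define n where "n = 3 * k + 1"
  let ?E = "ehrhart_poly Pk" and ?h = "hstar_poly Pk"
  have "0 < k" by (simp add: k_def)
  have E: "?E = (smult (1 / 3) ([:1, 1:] * [:3, -1, 4:])) ^ k"
    by (simp add: assms ehrhart_poly_cart_power_tetra k_def)
  have E012: "poly ?E 0 = 1" "poly ?E 1 = 4 ^ k" "poly ?E 2 = 17 ^ k"
    unfolding E by (simp_all add: poly_power)
  have pow: "(16::real) ^ k < 17 ^ k" using \<open>0 < k\<close> by (intro power_strict_mono) auto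
  have sq: "((4::real) ^ k)\<^sup>2 = 16 ^ k" by (simp add: power2_eq_square flip: power_mult_distrib)

  have "coeff (f_poly Pk) 0 = 1" "coeff (f_poly Pk) 1 = 4 ^ k - 1"
    "coeff (f_poly Pk) 2 = 17 ^ k - 2 * 4 ^ k + 1"
    using E012 by (simp_all add: f_poly_def coeff_binom_to_monom numeral_2_eq_2 poly_fwd_diff)
  then have f: "(coeff (f_poly Pk) 1)\<^sup>2 < coeff (f_poly Pk) 0 * coeff (f_poly Pk) 2"
    using pow sq by (simp add: power2_diff)

  have "n = nat (aff_dim Pk + 1)"
    by (simp add: assms aff_dim_cart_power_tetra n_def k_def nat_add_distrib nat_mult_distrib)
  moreover have "degree ?E < n"
    unfolding E by (simp add: degree_power_eq n_def)
  ultimately have h: "coeff ?h 0 = 1" "coeff ?h 1 = 4 ^ k - real n"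
    "coeff ?h 2 = 17 ^ k - real n * 4 ^ k + real n * (real n - 1) / 2"
    using coeff_hstar_poly[of Pk n] E012 by simp_all
  \<comment> \<open>Bernoulli's inequality at 1 + 3 yields exactly n <= 4^k.\<close>
  have "1 + real k * 3 \<le> (1 + 3) ^ k" by (rule Bernoulli_inequality) simp
  then have "real n \<le> 4 ^ k" by (simp add: n_def)
  then have "real n * real n \<le> real n * 4 ^ k" by (intro mult_left_mono) auto
  moreover have "0 \<le> real n * (real n - 1) / 2" by (simp add: n_def)
  moreover have "(4 ^ k - real n)\<^sup>2 = 16 ^ k - 2 * (real n * 4 ^ k) + real n * real n"
    unfolding power2_diff sq by (simp add: power2_eq_square)
  \<comment> \<open>The gap is (17^k - 16^k) + n (4^k - n) + n (n - 1) / 2, a positive term plus two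
    nonnegative ones.\<close>
  ultimately have less: "(coeff ?h 1)\<^sup>2 < coeff ?h 2"
    unfolding h using pow by linarith
  then have pos: "0 < coeff ?h 2" by (smt (verit) zero_le_power2)
  \<comment> \<open>Log-concavity is only tested strictly below the degree, so degree at least 2
    makes index 1 admissible.\<close>
  then have "2 \<le> degree ?h" by (intro le_degree) simp
  then have "\<not> log_concave ?h"
    using less h(1) by (auto simp: log_concave_def numeral_2_eq_2 intro!: exI[of _ 1])
  \<comment> \<open>Real-rootedness would give 2 h_2 <= h_1^2 < h_2, contradicting h_2 > 0.\<close>
  moreover have "\<not> real_rooted ?h"
    using real_rooted_coeff_ineq[OF _ h(1)] less pos by force
  ultimately show ?thesis using f by blast
qed

end
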